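(* Let $(\Gamma,\Pi)$ be a finitely separated digraph with vertex set $V$ and let $L=L_{\mathbb F}(\Gamma,\Pi)$ be its Leavitt path algebra over a field $\mathbb F$. If $d$ is a dimension function for $\Gamma$ then there exists an $L$-module $M$ with $\dim^{\mathbb F}(Mv)=d(v)$ for all $v\in V$. Hence $L$ has a nonzero finite dimensional module if and only if $\Gamma$ has a nonzero dimension function of finite support.
   Context: A digraph $\Gamma=(V,E,s,t)$ has vertex set $V$, arrow set $E$ (both possibly infinite) and source and target maps $s,t:E\to V$; write $se,te$ for $s(e),t(e)$. A separated digraph is a pair $(\Gamma,\Pi)$ where $\Pi$ is a partition of $E$ such that arrows in the same part $X\in\Pi$ have the same source, denoted $sX$. It is finitely separated if every $X\in\Pi$ is finite. $L=L_{\mathbb F}(\Gamma,\Pi)$ is the (not necessarily unital) $\mathbb F$-algebra generated by $V\sqcup E\sqcup E^*$, where $E^*=\{e^*: e\in E\}$, $s(e^* )=te$, $t(e^* )=se$, subject to: (V) $vw=\delta_{v,w}v$ for $v,w\in V$; (E) $s(e)e=e=e\,t(e)$ for $e\in E\sqcup E^*$; (SCK1) $e^*f=\delta_{e,f}\,te$ for $e,f\in X$, $X\in\Pi$; (SCK2) $sX=\sum_{e\in X}ee^*$ for every finite $X\in\Pi$. Modules are right modules that are unital, i.e. $ML=M$. A dimension function of a finitely separated digraph $\Gamma$ is a function $d:V\to\mathbb N=\{0,1,2,\dots\}$ satisfying $d(sX)=\sum_{e\in X}d(te)$ for all $X\in\Pi$; its support is $\{v\in V: d(v)\neq0\}$.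 *)

theory Defs
  imports
    "Graph_Theory.Digraph"
    "HOL-Library.Disjoint_Sets"
    "HOL-Library.Poly_Mapping"
begin

section \<open>Separated digraphs and dimension functions\<close>

text \<open>
  \<open>wf_digraph\<close> allows infinitely many vertices and arcs, loops and parallel arcs;
  \<open>tail\<close> is the source map and \<open>head\<close> the target map.
\<close>

locale separated_digraph = wf_digraph \<Gamma>
  for \<Gamma> :: "('v, 'e) pre_digraph" +
  fixes P :: "'e set set"
  assumes partition: "partition_on (arcs \<Gamma>) P"
    and same_source: "X \<in> P \<Longrightarrow> e \<in> X \<Longrightarrow> f \<in> X \<Longrightarrow> tail \<Gamma> e = tail \<Gamma> f"

locale finitely_separated_digraph = separated_digraph +
  assumes finite_part: "X \<in> P \<Longrightarrow> finite X"

text \<open>The parts of a partition are nonempty, so the common source \<open>sX\<close> is determined.\<close>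

definition part_source :: "('v, 'e) pre_digraph \<Rightarrow> 'e set \<Rightarrow> 'v" where
  "part_source \<Gamma> X = the_elem (tail \<Gamma> ` X)"

text \<open>
  Only the values of \<open>d\<close> on \<open>verts \<Gamma>\<close> are relevant, here and in the support.
\<close>

definition dimension_function ::
    "('v, 'e) pre_digraph \<Rightarrow> 'e set set \<Rightarrow> ('v \<Rightarrow> nat) \<Rightarrow> bool" where
  "dimension_function \<Gamma> P d \<longleftrightarrow> (\<forall>X\<in>P. d (part_source \<Gamma> X) = (\<Sum>e\<in>X. d (head \<Gamma> e)))"

definition dim_support :: "('v, 'e) pre_digraph \<Rightarrow> ('v \<Rightarrow> nat) \<Rightarrow> 'v set" where
  "dim_support \<Gamma> d = {v \<in> verts \<Gamma>. d v \<noteq> 0}"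


section \<open>Free algebras\<close>

text \<open>
  Words are a copy of lists, with concatenation written additively because the
  multiplication of \<open>poly_mapping\<close> is convolution with respect to \<open>+\<close>. Thus
  \<open>'g fword \<Rightarrow>\<^sub>0 'f\<close> is the free unital algebra on \<open>'g\<close>.
\<close>

datatype 'g fword = Word (letters: "'g list")

instantiation fword :: (type) monoid_add
begin

definition zero_fword :: "'a fword" where
  "0 = Word []"

definition plus_fword :: "'a fword \<Rightarrow> 'a fword \<Rightarrow> 'a fword" where
  "u + w = Word (letters u @ letters w)"

instance
  by standard (simp_all add: zero_fword_def plus_fword_def)

end

abbreviation pm_scale :: "'f::field \<Rightarrow> ('a \<Rightarrow>\<^sub>0 'f) \<Rightarrow> ('a \<Rightarrow>\<^sub>0 'f)" where
  "pm_scale c \<equiv> Poly_Mapping.map ((*) c)"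

definition gen :: "'g \<Rightarrow> ('g fword \<Rightarrow>\<^sub>0 'f::field)" where
  "gen g = Poly_Mapping.single (Word [g]) 1"

text \<open>
  The free non-unital algebra on a set \<open>G\<close> of generators: no constant term, and only
  letters from \<open>G\<close>.
\<close>

definition free_algebra :: "'g set \<Rightarrow> ('g fword \<Rightarrow>\<^sub>0 'f::field) set" where
  "free_algebra G =
     {p. \<forall>w \<in> Poly_Mapping.keys p. letters w \<noteq> [] \<and> set (letters w) \<subseteq> G}"

text \<open>
  The two-sided ideal of \<open>free_algebra G\<close> generated by \<open>R\<close>. As the algebra has no unit,
  closure under scalars has to be required separately.
\<close>

inductive_set generated_ideal ::
    "'g set \<Rightarrow> ('g fword \<Rightarrow>\<^sub>0 'f::field) set \<Rightarrow> ('g fword \<Rightarrow>\<^sub>0 'f) set"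
  for G R where
  zero: "0 \<in> generated_ideal G R"
| base: "r \<in> R \<Longrightarrow> r \<in> generated_ideal G R"
| add: "p \<in> generated_ideal G R \<Longrightarrow> q \<in> generated_ideal G R \<Longrightarrow> p + q \<in> generated_ideal G R"
| scale: "p \<in> generated_ideal G R \<Longrightarrow> pm_scale c p \<in> generated_ideal G R"
| left: "a \<in> free_algebra G \<Longrightarrow> p \<in> generated_ideal G R \<Longrightarrow> a * p \<in> generated_ideal G R"
| right: "a \<in> free_algebra G \<Longrightarrow> p \<in> generated_ideal G R \<Longrightarrow> p * a \<in> generated_ideal G R"


section \<open>Algebras given by generators and relations\<close>

record ('f, 'a) falgebra =
  acarrier :: "'a set"
  aadd :: "'a \<Rightarrow> 'a \<Rightarrow> 'a"
  amult :: "'a \<Rightarrow> 'a \<Rightarrow> 'a"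
  asmult :: "'f \<Rightarrow> 'a \<Rightarrow> 'a"

definition ideal_cong ::
    "'g set \<Rightarrow> ('g fword \<Rightarrow>\<^sub>0 'f::field) set \<Rightarrow> (('g fword \<Rightarrow>\<^sub>0 'f) \<times> ('g fword \<Rightarrow>\<^sub>0 'f)) set" where
  "ideal_cong G R =
     {(p, q). p \<in> free_algebra G \<and> q \<in> free_algebra G \<and> p - q \<in> generated_ideal G R}"

definition presented_algebra ::
    "'g set \<Rightarrow> ('g fword \<Rightarrow>\<^sub>0 'f::field) set \<Rightarrow> ('f, ('g fword \<Rightarrow>\<^sub>0 'f) set) falgebra" where
  "presented_algebra G R =
     \<lparr> acarrier = free_algebra G // ideal_cong G R,
       aadd = (\<lambda>A B. \<Union>a\<in>A. \<Union>b\<in>B. ideal_cong G R `` {a + b}),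
       amult = (\<lambda>A B. \<Union>a\<in>A. \<Union>b\<in>B. ideal_cong G R `` {a * b}),
       asmult = (\<lambda>c A. \<Union>a\<in>A. ideal_cong G R `` {pm_scale c a}) \<rparr>"


section \<open>Leavitt path algebras of separated digraphs\<close>

datatype ('v, 'e) lpa_gen = Vertex 'v | Arrow 'e | Star 'e

primrec gsource :: "('v, 'e) pre_digraph \<Rightarrow> ('v, 'e) lpa_gen \<Rightarrow> 'v" where
  "gsource \<Gamma> (Vertex v) = v"
| "gsource \<Gamma> (Arrow e) = tail \<Gamma> e"
| "gsource \<Gamma> (Star e) = head \<Gamma> e"

primrec gtarget :: "('v, 'e) pre_digraph \<Rightarrow> ('v, 'e) lpa_gen \<Rightarrow> 'v" where
  "gtarget \<Gamma> (Vertex v) = v"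
| "gtarget \<Gamma> (Arrow e) = head \<Gamma> e"
| "gtarget \<Gamma> (Star e) = tail \<Gamma> e"

definition lpa_gens :: "('v, 'e) pre_digraph \<Rightarrow> ('v, 'e) lpa_gen set" where
  "lpa_gens \<Gamma> = Vertex ` verts \<Gamma> \<union> Arrow ` arcs \<Gamma> \<union> Star ` arcs \<Gamma>"

text \<open>The four components of the union are, in this order, the relations (V), (E), (SCK1)
  and (SCK2).\<close>

definition lpa_relations ::
    "('v, 'e) pre_digraph \<Rightarrow> 'e set set \<Rightarrow> (('v, 'e) lpa_gen fword \<Rightarrow>\<^sub>0 'f::field) set" where
  "lpa_relations \<Gamma> P =
     {gen (Vertex v) * gen (Vertex w) - (if v = w then gen (Vertex v) else 0) | v w.
        v \<in> verts \<Gamma> \<and> w \<in> verts \<Gamma>} \<union>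
     (\<Union>x \<in> Arrow ` arcs \<Gamma> \<union> Star ` arcs \<Gamma>.
        {gen (Vertex (gsource \<Gamma> x)) * gen x - gen x,
         gen x * gen (Vertex (gtarget \<Gamma> x)) - gen x}) \<union>
     {gen (Star e) * gen (Arrow f) - (if e = f then gen (Vertex (head \<Gamma> e)) else 0) | e f X.
        X \<in> P \<and> e \<in> X \<and> f \<in> X} \<union>
     {gen (Vertex (part_source \<Gamma> X)) - (\<Sum>e\<in>X. gen (Arrow e) * gen (Star e)) | X.
        X \<in> P \<and> finite X}"

definition leavitt_path_algebra ::
    "('v, 'e) pre_digraph \<Rightarrow> 'e set set \<Rightarrow>
     ('f::field, (('v, 'e) lpa_gen fword \<Rightarrow>\<^sub>0 'f) set) falgebra" where
  "leavitt_path_algebra \<Gamma> P = presented_algebra (lpa_gens \<Gamma>) (lpa_relations \<Gamma> P)"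

definition lpa_vertex ::
    "('v, 'e) pre_digraph \<Rightarrow> 'e set set \<Rightarrow> 'v \<Rightarrow> (('v, 'e) lpa_gen fword \<Rightarrow>\<^sub>0 'f::field) set" where
  "lpa_vertex \<Gamma> P v = ideal_cong (lpa_gens \<Gamma>) (lpa_relations \<Gamma> P) `` {gen (Vertex v)}"


section \<open>Modules\<close>

text \<open>
  A unital right module over an \<open>F\<close>-algebra \<open>A\<close> which need not have a unit: an \<open>F\<close>-vector
  space \<open>M\<close>, given as a subspace of an ambient one, with a bilinear associative action of
  \<open>A\<close> such that \<open>MA = M\<close>, where \<open>MA\<close> consists of the finite sums of products.

  HOL has no quantification over types, so existential statements about modules must name
  an ambient space. A direct sum over the vertices of finite dimensional spaces embeds into
  \<open>'v \<times> nat \<Rightarrow>\<^sub>0 'f\<close>, so that space hosts an isomorphic copy of every such module.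
\<close>

locale unital_right_module = vector_space scale
  for scale :: "'f::field \<Rightarrow> 'm::ab_group_add \<Rightarrow> 'm" +
  fixes A :: "('f, 'a) falgebra"
    and M :: "'m set"
    and act :: "'m \<Rightarrow> 'a \<Rightarrow> 'm"
  assumes subspace_M: "subspace M"
    and act_closed: "m \<in> M \<Longrightarrow> a \<in> acarrier A \<Longrightarrow> act m a \<in> M"
    and act_add_left: "m \<in> M \<Longrightarrow> n \<in> M \<Longrightarrow> a \<in> acarrier A \<Longrightarrow>
          act (m + n) a = act m a + act n a"
    and act_add_right: "m \<in> M \<Longrightarrow> a \<in> acarrier A \<Longrightarrow> b \<in> acarrier A \<Longrightarrow>
          act m (aadd A a b) = act m a + act m b"
    and act_scale_left: "m \<in> M \<Longrightarrow> a \<in> acarrier A \<Longrightarrow> act (scale c m) a = scale c (act m a)"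
    and act_scale_right: "m \<in> M \<Longrightarrow> a \<in> acarrier A \<Longrightarrow> act m (asmult A c a) = scale c (act m a)"
    and act_assoc: "m \<in> M \<Longrightarrow> a \<in> acarrier A \<Longrightarrow> b \<in> acarrier A \<Longrightarrow>
          act m (amult A a b) = act (act m a) b"
    and unital: "span {act m a | m a. m \<in> M \<and> a \<in> acarrier A} = M"

definition finite_dim :: "('f::field \<Rightarrow> 'm::ab_group_add \<Rightarrow> 'm) \<Rightarrow> 'm set \<Rightarrow> bool" where
  "finite_dim scale S \<longleftrightarrow> (\<exists>B. finite B \<and> S \<subseteq> module.span scale B)"

text \<open>
  The library's \<open>dim\<close> is meaningless in infinite dimension (the cardinality of an infinite
  basis is \<open>0\<close>), hence the conjunct \<open>finite_dim\<close>.
\<close>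

definition has_dim :: "('f::field \<Rightarrow> 'm::ab_group_add \<Rightarrow> 'm) \<Rightarrow> 'm set \<Rightarrow> nat \<Rightarrow> bool" where
  "has_dim scale S n \<longleftrightarrow> finite_dim scale S \<and> vector_space.dim scale S = n"

end

theory Submission
  imports Defs
begin

text \<open>
  The relation (SCK2) says that \<open>m \<mapsto> (m e)\<^sub>e\<close> identifies \<open>M sX\<close> with the direct sum of the
  spaces \<open>M te\<close>, \<open>e \<in> X\<close>, the inverse being \<open>(m\<^sub>e)\<^sub>e \<mapsto> \<Sum>\<^sub>e m\<^sub>e e\<^sup>*\<close>. Hence \<open>v \<mapsto> dim (M v)\<close> is a
  dimension function whenever these dimensions are finite; its support is finite because the
  \<open>M v\<close> are independent, and nonempty because \<open>M L = M\<close> is spanned by the \<open>M v\<close>.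
  Conversely, given \<open>d\<close>, take a space \<open>M\<^sub>v\<close> of dimension \<open>d v\<close> for each vertex. For every part
  \<open>X\<close> the dimension equation provides an isomorphism between \<open>M\<^bsub>sX\<^esub>\<close> and the direct sum of
  the \<open>M\<^bsub>te\<^esub>\<close>, \<open>e \<in> X\<close>; let \<open>e\<close> and \<open>e\<^sup>*\<close> act as its projections and inclusions.
\<close>

section \<open>Linear extension\<close>

lemma lookup_pm_scale [simp]:
  "Poly_Mapping.lookup (pm_scale c p) k = c * Poly_Mapping.lookup p k"
  by (transfer fixing: c) (simp add: when_def)

interpretation pm: vector_space pm_scale
  by standard (auto intro!: poly_mapping_eqI simp: lookup_add algebra_simps)

lemma pm_scale_single: "pm_scale c (Poly_Mapping.single k a) = Poly_Mapping.single k (c * a)"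
  by (rule poly_mapping_eqI) (simp add: lookup_single when_def)

lemma keys_pm_scale: "Poly_Mapping.keys (pm_scale c p) \<subseteq> Poly_Mapping.keys p"
  by (auto simp: in_keys_iff)

lemma poly_mapping_eq_sum_single:
  "p = (\<Sum>k\<in>Poly_Mapping.keys p. pm_scale (Poly_Mapping.lookup p k) (Poly_Mapping.single k 1))"
  by (rule poly_mapping_eqI)
    (auto simp: lookup_sum lookup_single when_def in_keys_iff if_distrib sum.delta cong: if_cong)

lemma linear_pm_eqI:
  assumes f: "Vector_Spaces.linear pm_scale scale f" and g: "Vector_Spaces.linear pm_scale scale g"
    and eq: "\<And>k. f (Poly_Mapping.single k 1) = g (Poly_Mapping.single k 1)"
  shows "f p = g p"
proof -
  interpret f: Vector_Spaces.linear pm_scale scale f by fact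
  interpret g: Vector_Spaces.linear pm_scale scale g by fact
  show ?thesis
    by (subst (1 2) poly_mapping_eq_sum_single[of p]) (simp add: f.sum g.sum f.scale g.scale eq del: map_single)
qed

text \<open>Constants are central although concatenation of words is not commutative. This is what
  lets a scalar pass either factor of a product.\<close>

lemma mult_single_0_commute:
  fixes p :: "'a::monoid_add \<Rightarrow>\<^sub>0 'f::field"
  shows "p * Poly_Mapping.single 0 c = Poly_Mapping.single 0 c * p"
  by (subst (1 2) poly_mapping_eq_sum_single[of p])
    (simp add: sum_distrib_left sum_distrib_right pm_scale_single mult_single mult.commute)

lemma pm_scale_mult_left: "pm_scale c p * q = pm_scale c (p * q)"
  and pm_scale_mult_right: "p * pm_scale c q = pm_scale c (p * q)"
  for p q :: "'a::monoid_add \<Rightarrow>\<^sub>0 'f::field"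
  by (simp_all add: mult_map_scale_conv_mult mult.assoc)
    (simp flip: mult.assoc add: mult_single_0_commute)

section \<open>Evaluation of noncommutative polynomials at operators\<close>

definition lin_ext :: "('a::field \<Rightarrow> 'b::ab_group_add \<Rightarrow> 'b) \<Rightarrow> ('k \<Rightarrow> 'b) \<Rightarrow> ('k \<Rightarrow>\<^sub>0 'a) \<Rightarrow> 'b" where
  "lin_ext s f p = (\<Sum>k\<in>Poly_Mapping.keys p. s (Poly_Mapping.lookup p k) (f k))"

text \<open>\<open>fold\<close> applies the first letter first, the order in which a word acts on a
  vector standing to its left, as right modules require.\<close>

definition eval_rep ::
    "('a::field \<Rightarrow> 'b::ab_group_add \<Rightarrow> 'b) \<Rightarrow> ('g \<Rightarrow> 'b \<Rightarrow> 'b) \<Rightarrow> ('g fword \<Rightarrow>\<^sub>0 'a) \<Rightarrow> 'b \<Rightarrow> 'b" where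
  "eval_rep s T p m = lin_ext s (\<lambda>w. fold T (letters w) m) p"

context vector_space
begin

text \<open>Two polynomials with different supports can be summed over a common index set, which
  additivity of \<open>lin_ext\<close> requires.\<close>

lemma lin_ext_eq_sum:
  fixes p :: "'k \<Rightarrow>\<^sub>0 'a"
  assumes "finite S" "Poly_Mapping.keys p \<subseteq> S"
  shows "lin_ext scale f p = (\<Sum>k\<in>S. scale (Poly_Mapping.lookup p k) (f k))"
  unfolding lin_ext_def using assms by (intro sum.mono_neutral_left) (auto simp: in_keys_iff)

lemma lin_ext_single [simp]: "lin_ext scale f (Poly_Mapping.single k c) = scale c (f k)"
  by (simp add: lin_ext_eq_sum[of "{k}"])

lemma linear_lin_ext:
  fixes f :: "'k \<Rightarrow> 'b"
  shows "Vector_Spaces.linear pm_scale scale (lin_ext scale f)"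
proof (rule Vector_Spaces.linear_iff[THEN iffD2], intro conjI allI)
  fix p q :: "'k \<Rightarrow>\<^sub>0 'a" and c :: 'a
  show "lin_ext scale f (p + q) = lin_ext scale f p + lin_ext scale f q"
    using keys_add[of p q]
    by (simp add: lin_ext_eq_sum[of "Poly_Mapping.keys p \<union> Poly_Mapping.keys q"]
        lookup_add scale_left_distrib sum.distrib)
  show "lin_ext scale f (pm_scale c p) = scale c (lin_ext scale f p)"
    by (simp add: lin_ext_eq_sum[of "Poly_Mapping.keys p"] keys_pm_scale scale_sum_right)
qed (unfold_locales)

lemma eval_rep_gen [simp]: "eval_rep scale T (gen g) m = T g m"
  by (simp add: eval_rep_def gen_def)

lemma linear_eval_rep: "Vector_Spaces.linear pm_scale scale (\<lambda>p. eval_rep scale T p m)"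
  unfolding eval_rep_def by (rule linear_lin_ext)

lemma linear_fold:
  assumes "\<And>g. Vector_Spaces.linear scale scale (T g)"
  shows "Vector_Spaces.linear scale scale (fold T ws)"
proof (induction ws)
  case Nil
  show ?case using linear_id by (simp add: id_def)
next
  case (Cons g ws)
  show ?case
    using Vector_Spaces.linear_compose[OF assms[of g] Cons] by (simp add: comp_def)
qed

lemma linear_eval_rep_vector:
  assumes "\<And>g. Vector_Spaces.linear scale scale (T g)"
  shows "Vector_Spaces.linear scale scale (eval_rep scale T p)"
proof (rule Vector_Spaces.linear_iff[THEN iffD2], intro conjI allI)
  fix m n :: 'b and c :: 'a
  interpret w: Vector_Spaces.linear scale scale "fold T ws" for ws
    by (rule linear_fold) fact
  show "eval_rep scale T p (m + n) = eval_rep scale T p m + eval_rep scale T p n"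
    by (simp add: eval_rep_def lin_ext_def w.add scale_right_distrib sum.distrib)
  show "eval_rep scale T p (scale c m) = scale c (eval_rep scale T p m)"
    by (simp add: eval_rep_def lin_ext_def w.scale scale_sum_right mult.commute)
qed (unfold_locales)

text \<open>On words, concatenation becomes composition of folds. Linearity extends this to
  polynomials, first in the second factor while the first one is a word, then in the first
  factor.\<close>

lemma eval_rep_mult:
  fixes T :: "'g \<Rightarrow> 'b \<Rightarrow> 'b" and p q :: "'g fword \<Rightarrow>\<^sub>0 'a" and m :: 'b
  assumes "\<And>g. Vector_Spaces.linear scale scale (T g)"
  shows "eval_rep scale T (p * q) m = eval_rep scale T q (eval_rep scale T p m)"
proof -
  interpret e: Vector_Spaces.linear pm_scale scale "\<lambda>r. eval_rep scale T r n" for n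
    by (rule linear_eval_rep)
  interpret v: Vector_Spaces.linear scale scale "eval_rep scale T r" for r
    by (rule linear_eval_rep_vector) fact
  have base: "eval_rep scale T (Poly_Mapping.single u 1 * r) m
      = eval_rep scale T r (eval_rep scale T (Poly_Mapping.single u 1) m)" for u r
  proof (rule linear_pm_eqI[where p = r
        and f = "\<lambda>q. eval_rep scale T (Poly_Mapping.single u 1 * q) m"
        and g = "\<lambda>q. eval_rep scale T q (eval_rep scale T (Poly_Mapping.single u 1) m)"])
    show "Vector_Spaces.linear pm_scale scale (\<lambda>q. eval_rep scale T (Poly_Mapping.single u 1 * q) m)"
      by (rule Vector_Spaces.linear_iff[THEN iffD2])
        (simp add: distrib_left e.add pm_scale_mult_right e.scale pm.vector_space_axioms
          vector_space_axioms)
  qed (auto simp: linear_lin_ext mult_single eval_rep_def plus_fword_def)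
  have "Vector_Spaces.linear pm_scale scale (\<lambda>p. eval_rep scale T (p * q) m)"
    by (rule Vector_Spaces.linear_iff[THEN iffD2])
      (simp add: distrib_right e.add pm_scale_mult_left e.scale pm.vector_space_axioms
        vector_space_axioms)
  moreover have "Vector_Spaces.linear pm_scale scale
      (\<lambda>p. eval_rep scale T q (eval_rep scale T p m))"
    by (rule Vector_Spaces.linear_iff[THEN iffD2])
      (simp add: e.add e.scale v.add v.scale pm.vector_space_axioms vector_space_axioms)
  ultimately show ?thesis
    using base by (rule linear_pm_eqI)
qed

end

section \<open>Presented algebras\<close>

lemma subspace_free_algebra: "pm.subspace (free_algebra G)"
  unfolding free_algebra_def pm.subspace_def
  using keys_add keys_pm_scale by (fastforce simp: subset_iff)

lemma free_algebra_mult: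
  assumes "p \<in> free_algebra G" "q \<in> free_algebra G"
  shows "p * q \<in> free_algebra G"
  using assms keys_mult[of p q] unfolding free_algebra_def
  by (fastforce simp: plus_fword_def subset_iff)

lemma gen_in_free_algebra [simp]: "gen g \<in> free_algebra G \<longleftrightarrow> g \<in> G"
  by (simp add: gen_def free_algebra_def)

lemma subspace_generated_ideal: "pm.subspace (generated_ideal G R)"
  unfolding pm.subspace_def by (simp add: generated_ideal.intros)

lemmas free_algebra_simps [simp, intro] =
  free_algebra_mult
  pm.subspace_0[OF subspace_free_algebra] pm.subspace_add[OF subspace_free_algebra]
  pm.subspace_scale[OF subspace_free_algebra] pm.subspace_diff[OF subspace_free_algebra]
  pm.subspace_sum[OF subspace_free_algebra]

section \<open>The quotient of the free algebra by the ideal\<close>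

lemma equiv_ideal_cong: "equiv (free_algebra G) (ideal_cong G R)"
proof (rule equivI)
  show "ideal_cong G R \<subseteq> free_algebra G \<times> free_algebra G"
    by (auto simp: ideal_cong_def)
  show "refl_on (free_algebra G) (ideal_cong G R)"
    by (auto simp: refl_on_def ideal_cong_def generated_ideal.zero)
  show "sym (ideal_cong G R)"
    by (rule symI) (use pm.subspace_neg[OF subspace_generated_ideal] in \<open>force simp: ideal_cong_def\<close>)
  show "trans (ideal_cong G R)"
    by (rule transI) (use generated_ideal.add in \<open>force simp: ideal_cong_def\<close>)
qed

definition residue :: "'g set \<Rightarrow> ('g fword \<Rightarrow>\<^sub>0 'f::field) set \<Rightarrow>
    ('g fword \<Rightarrow>\<^sub>0 'f) \<Rightarrow> ('g fword \<Rightarrow>\<^sub>0 'f) set" where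
  "residue G R p = ideal_cong G R `` {p}"

lemma acarrier_presented: "acarrier (presented_algebra G R) = residue G R ` free_algebra G"
  by (auto simp: presented_algebra_def quotient_def residue_def)

lemma residue_eqI:
  assumes "p - q \<in> generated_ideal G R" "p \<in> free_algebra G" "q \<in> free_algebra G"
  shows "residue G R p = residue G R q"
  unfolding residue_def
  by (rule equiv_class_eq[OF equiv_ideal_cong]) (use assms in \<open>simp add: ideal_cong_def\<close>)

text \<open>The operations of \<open>presented_algebra\<close> are unions over all representatives.
  Compatibility with the congruence makes all members of such a union equal, so that it collapses to
  a single class.\<close>

lemma residue_add:
  assumes "p \<in> free_algebra G" "q \<in> free_algebra G"
  shows "aadd (presented_algebra G R) (residue G R p) (residue G R q) = residue G R (p + q)"
proof -
  have "congruent2 (ideal_cong G R) (ideal_cong G R) (\<lambda>a b. ideal_cong G R `` {a + b})"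
  proof (rule congruent2I', rule equiv_class_eq[OF equiv_ideal_cong])
    fix a a' b b' assume "(a, a') \<in> ideal_cong G R" "(b, b') \<in> ideal_cong G R"
    then show "(a + b, a' + b') \<in> ideal_cong G R"
      using generated_ideal.add[of "a - a'" G R "b - b'"]
      by (auto simp: ideal_cong_def add_diff_add)
  qed
  then show ?thesis
    using UN_equiv_class2[OF equiv_ideal_cong equiv_ideal_cong _ assms]
    by (simp add: presented_algebra_def residue_def)
qed

lemma residue_mult:
  assumes "p \<in> free_algebra G" "q \<in> free_algebra G"
  shows "amult (presented_algebra G R) (residue G R p) (residue G R q) = residue G R (p * q)"
proof -
  have "congruent2 (ideal_cong G R) (ideal_cong G R) (\<lambda>a b. ideal_cong G R `` {a * b})"
  proof (rule congruent2I', rule equiv_class_eq[OF equiv_ideal_cong])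
    fix a a' b b' assume ab: "(a, a') \<in> ideal_cong G R" "(b, b') \<in> ideal_cong G R"
    \<comment> \<open>Only one factor is changed at a time, so that each summand is a multiple of an
      element of the ideal.\<close>
    have "a * b - a' * b' = a * (b - b') + (a - a') * b'"
      by (simp add: algebra_simps)
    also have "\<dots> \<in> generated_ideal G R"
      using ab by (intro generated_ideal.add generated_ideal.left generated_ideal.right)
        (auto simp: ideal_cong_def)
    finally show "(a * b, a' * b') \<in> ideal_cong G R"
      using ab by (auto simp: ideal_cong_def)
  qed
  then show ?thesis
    using UN_equiv_class2[OF equiv_ideal_cong equiv_ideal_cong _ assms]
    by (simp add: presented_algebra_def residue_def)
qed

lemma residue_scale:
  assumes "p \<in> free_algebra G"
  shows "asmult (presented_algebra G R) c (residue G R p) = residue G R (pm_scale c p)"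
proof -
  have "congruent (ideal_cong G R) (\<lambda>a. ideal_cong G R `` {pm_scale c a})"
  proof (rule congruentI, rule equiv_class_eq[OF equiv_ideal_cong])
    fix a a' assume "(a, a') \<in> ideal_cong G R"
    then show "(pm_scale c a, pm_scale c a') \<in> ideal_cong G R"
      using generated_ideal.scale[of "a - a'" G R c]
      by (auto simp: ideal_cong_def pm.scale_right_diff_distrib)
  qed
  then show ?thesis
    using UN_equiv_class[OF equiv_ideal_cong _ assms]
    by (simp add: presented_algebra_def residue_def)
qed

text \<open>Operators that satisfy the relations annihilate the whole ideal, so evaluation descends
  to the quotient. They are linear and satisfy the relations on the entire ambient space, while
  invariance of \<open>M\<close> is asked only for letters in \<open>G\<close>. Unitality is checked
  on generators, as their images already span.\<close>

lemma (in vector_space) module_of_representation: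
  fixes T :: "'g \<Rightarrow> 'b \<Rightarrow> 'b"
  assumes lin: "\<And>g. Vector_Spaces.linear scale scale (T g)"
    and rel: "\<And>r m. r \<in> R \<Longrightarrow> eval_rep scale T r m = 0"
    and M: "subspace M" "\<And>g m. g \<in> G \<Longrightarrow> m \<in> M \<Longrightarrow> T g m \<in> M"
    and unital: "M \<subseteq> span {T g m | g m. g \<in> G \<and> m \<in> M}"
  obtains act where "unital_right_module scale (presented_algebra G R) M act"
    and "\<And>p m. p \<in> free_algebra G \<Longrightarrow> act m (residue G R p) = eval_rep scale T p m"
proof -
  interpret e: Vector_Spaces.linear pm_scale scale "\<lambda>p. eval_rep scale T p m" for m
    by (rule linear_eval_rep)
  interpret v: Vector_Spaces.linear scale scale "eval_rep scale T p" for p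
    by (rule linear_eval_rep_vector) fact
  have ideal: "eval_rep scale T p m = 0" if "p \<in> generated_ideal G R" for p m
    using that
    by (induction arbitrary: m) (simp_all add: rel e.add e.scale eval_rep_mult[OF lin])
  \<comment> \<open>By \<open>ideal\<close>, the choice of a representative of the class
    \<open>a\<close> does not affect the operator.\<close>
  define act where "act m a = eval_rep scale T (SOME p. p \<in> a) m" for m and a :: "('g fword \<Rightarrow>\<^sub>0 'a) set"
  have act: "act m (residue G R p) = eval_rep scale T p m" if "p \<in> free_algebra G" for p m
  proof -
    have "p \<in> residue G R p"
      using equiv_class_self[OF equiv_ideal_cong that] by (simp add: residue_def)
    then have "(SOME q. q \<in> residue G R p) \<in> residue G R p"
      by (rule someI)
    then have "p - (SOME q. q \<in> residue G R p) \<in> generated_ideal G R"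
      unfolding residue_def ideal_cong_def by blast
    from ideal[OF this] show ?thesis
      by (simp add: act_def e.diff)
  qed
  have fold_M: "fold T ws m \<in> M" if "m \<in> M" "set ws \<subseteq> G" for ws m
    using that by (induction ws arbitrary: m) (auto intro: M)
  have eval_M: "eval_rep scale T p m \<in> M" if "m \<in> M" "p \<in> free_algebra G" for p m
    unfolding eval_rep_def lin_ext_def using that M
    by (auto intro!: subspace_sum subspace_scale fold_M simp: free_algebra_def)
  have span: "span {act m a | m a. m \<in> M \<and> a \<in> acarrier (presented_algebra G R)} = M"
  proof
    show "span {act m a | m a. m \<in> M \<and> a \<in> acarrier (presented_algebra G R)} \<subseteq> M"
      using M(1) by (intro span_minimal) (auto simp: acarrier_presented act eval_M)
    have "{T g m | g m. g \<in> G \<and> m \<in> M}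
        \<subseteq> {act m a | m a. m \<in> M \<and> a \<in> acarrier (presented_algebra G R)}"
    proof clarify
      fix g m assume "g \<in> G" "m \<in> M"
      then have "T g m = act m (residue G R (gen g))"
        by (simp add: act)
      with \<open>g \<in> G\<close> \<open>m \<in> M\<close> show "\<exists>m' a. T g m = act m' a \<and> m' \<in> M \<and>
          a \<in> acarrier (presented_algebra G R)"
        by (intro exI[of _ m] exI[of _ "residue G R (gen g)"]) (simp add: acarrier_presented)
    qed
    with unital show "M \<subseteq> span {act m a | m a. m \<in> M \<and> a \<in> acarrier (presented_algebra G R)}"
      using span_mono by blast
  qed
  have "unital_right_module scale (presented_algebra G R) M act"
    by (unfold_locales; (rule span)?)
      (auto simp: acarrier_presented residue_add residue_mult residue_scale act eval_M M
        e.add e.scale v.add v.scale eval_rep_mult[OF lin])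
  then show thesis
    using act that by blast
qed

section \<open>Modules over presented algebras\<close>

locale presented_module = unital_right_module scale "presented_algebra G R" M act
  for scale :: "'f::field \<Rightarrow> 'm::ab_group_add \<Rightarrow> 'm" and G :: "'g set" and R M act
begin

text \<open>The action pulled back to polynomials, where the relations can be applied directly.
  Since \<open>act\<close> is constrained only on \<open>M\<close> and on the carrier of the
  algebra, most laws below carry membership assumptions.\<close>

definition rop :: "('g fword \<Rightarrow>\<^sub>0 'f) \<Rightarrow> 'm \<Rightarrow> 'm" where
  "rop p m = act m (residue G R p)"

context
  fixes p :: "'g fword \<Rightarrow>\<^sub>0 'f"
  assumes p: "p \<in> free_algebra G"
begin

lemma residue_in_acarrier: "residue G R p \<in> acarrier (presented_algebra G R)"
  using p by (simp add: acarrier_presented)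

lemma rop_closed: "m \<in> M \<Longrightarrow> rop p m \<in> M"
  by (simp add: rop_def act_closed residue_in_acarrier)

lemma rop_vec_add: "m \<in> M \<Longrightarrow> n \<in> M \<Longrightarrow> rop p (m + n) = rop p m + rop p n"
  by (simp add: rop_def act_add_left residue_in_acarrier)

lemma rop_vec_scale: "m \<in> M \<Longrightarrow> rop p (scale c m) = scale c (rop p m)"
  by (simp add: rop_def act_scale_left residue_in_acarrier)

lemma rop_vec_0: "rop p 0 = 0"
  using rop_vec_scale[of 0 0] subspace_0[OF subspace_M] by simp

lemma rop_vec_sum: "(\<And>i. i \<in> I \<Longrightarrow> m i \<in> M) \<Longrightarrow> rop p (sum m I) = (\<Sum>i\<in>I. rop p (m i))"
  by (induction I rule: infinite_finite_induct)
    (simp_all add: rop_vec_0 rop_vec_add subspace_sum[OF subspace_M])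

lemma rop_scale: "m \<in> M \<Longrightarrow> rop (pm_scale c p) m = scale c (rop p m)"
  using act_scale_right[OF _ residue_in_acarrier] by (simp add: rop_def residue_scale[OF p])

lemma rop_image_span: "B \<subseteq> M \<Longrightarrow> b \<in> span B \<Longrightarrow> rop p b \<in> span (rop p ` B)"
proof -
  assume B: "B \<subseteq> M"
  assume "b \<in> span B"
  \<comment> \<open>Membership in \<open>M\<close> is carried through the induction because
    \<open>rop p\<close> is known to be additive only there.\<close>
  then have "b \<in> M \<and> rop p b \<in> span (rop p ` B)"
  proof (induction rule: span_induct_alt)
    case base
    show ?case by (simp add: rop_vec_0 span_zero subspace_0[OF subspace_M])
  next
    case (step c x y)
    then have "x \<in> M" "y \<in> M" using B by blast+
    then have "rop p (scale c x + y) = scale c (rop p x) + rop p y"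
      by (simp add: rop_vec_add rop_vec_scale subspace_scale[OF subspace_M])
    with step show ?case
      using \<open>x \<in> M\<close> \<open>y \<in> M\<close> subspace_M
      by (simp add: span_add span_scale span_base subspace_add subspace_scale)
  qed
  then show ?thesis ..
qed

end

lemma rop_add:
  "p \<in> free_algebra G \<Longrightarrow> q \<in> free_algebra G \<Longrightarrow> m \<in> M \<Longrightarrow> rop (p + q) m = rop p m + rop q m"
  using act_add_right[OF _ residue_in_acarrier residue_in_acarrier]
  by (simp add: rop_def flip: residue_add)

lemma rop_mult:
  "p \<in> free_algebra G \<Longrightarrow> q \<in> free_algebra G \<Longrightarrow> m \<in> M \<Longrightarrow> rop (p * q) m = rop q (rop p m)"
  using act_assoc[OF _ residue_in_acarrier residue_in_acarrier]
  by (simp add: rop_def flip: residue_mult)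

lemma rop_0: "m \<in> M \<Longrightarrow> rop 0 m = 0"
  using rop_add[of 0 0 m] by simp

lemma rop_sum:
  "(\<And>i. i \<in> I \<Longrightarrow> p i \<in> free_algebra G) \<Longrightarrow> m \<in> M \<Longrightarrow> rop (sum p I) m = (\<Sum>i\<in>I. rop (p i) m)"
  by (induction I rule: infinite_finite_induct) (simp_all add: rop_0 rop_add)

lemma rop_relation:
  "p - q \<in> R \<Longrightarrow> p \<in> free_algebra G \<Longrightarrow> q \<in> free_algebra G \<Longrightarrow> rop p m = rop q m"
  by (simp add: rop_def residue_eqI[OF generated_ideal.base])

text \<open>A nonempty word acts through its first letter, hence as zero, and the free non-unital
  algebra is spanned by such words. So the whole algebra acts as zero, and unitality leaves only the
  zero module.\<close>

lemma trivial_if_generators_act_trivially: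
  assumes gens: "\<And>g m. g \<in> G \<Longrightarrow> m \<in> M \<Longrightarrow> rop (gen g) m = 0"
  shows "M = {0}"
proof -
  have word: "rop (Poly_Mapping.single (Word ws) 1) m = 0"
    if "ws \<noteq> []" "set ws \<subseteq> G" "m \<in> M" for ws m
  proof (cases ws)
    case (Cons g us)
    show ?thesis
    \<comment> \<open>A one-letter word is treated apart: the empty word does not lie in the
      non-unital free algebra, so \<open>rop_mult\<close> could not split it off.\<close>
    proof (cases "us = []")
      case True
      with Cons that gens[of g m] show ?thesis by (simp add: gen_def)
    next
      case False
      have "Poly_Mapping.single (Word ws) 1
          = gen g * Poly_Mapping.single (Word us) (1 :: 'f)"
        by (simp add: gen_def mult_single plus_fword_def Cons)
      moreover have us: "Poly_Mapping.single (Word us) (1 :: 'f) \<in> free_algebra G"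
        using False Cons that by (simp add: free_algebra_def)
      ultimately show ?thesis
        using Cons that gens[of g m] by (simp add: rop_mult rop_vec_0)
    qed
  qed (use that in simp)
  have "rop p m = 0" if "p \<in> free_algebra G" "m \<in> M" for p m
  proof -
    have *: "Poly_Mapping.single w 1 \<in> free_algebra G"
      "rop (Poly_Mapping.single w 1) m = 0" if "w \<in> Poly_Mapping.keys p" for w
      using \<open>p \<in> free_algebra G\<close> \<open>m \<in> M\<close> that word[of "letters w" m]
      by (auto simp: free_algebra_def)
    have "rop p m = rop (\<Sum>w\<in>Poly_Mapping.keys p.
        pm_scale (Poly_Mapping.lookup p w) (Poly_Mapping.single w 1)) m"
      by (subst (1) poly_mapping_eq_sum_single[of p]) simp
    also have "\<dots> = (\<Sum>w\<in>Poly_Mapping.keys p.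
        rop (pm_scale (Poly_Mapping.lookup p w) (Poly_Mapping.single w 1)) m)"
      using *(1) \<open>m \<in> M\<close> by (intro rop_sum pm.subspace_scale[OF subspace_free_algebra]) simp_all
    also have "\<dots> = 0"
      using * \<open>m \<in> M\<close> by (intro sum.neutral ballI) (simp only: rop_scale[OF *(1)] scale_zero_right)
    finally show ?thesis .
  qed
  then have "{act m a | m a. m \<in> M \<and> a \<in> acarrier (presented_algebra G R)} \<subseteq> {0}"
    by (auto simp: acarrier_presented rop_def)
  then have "M \<subseteq> {0}"
    using unital span_minimal[OF _ subspace_single_0] by blast
  then show ?thesis
    using subspace_0[OF subspace_M] by blast
qed

end

section \<open>The dimension function of a module\<close>

lemma (in separated_digraph) part_source_eq:
  assumes "X \<in> P" "e \<in> X"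
  shows "part_source \<Gamma> X = tail \<Gamma> e"
proof -
  have "tail \<Gamma> ` X = {tail \<Gamma> e}"
    using assms same_source by blast
  then show ?thesis by (simp add: part_source_def)
qed

lemma (in separated_digraph) part_arcs: "X \<in> P \<Longrightarrow> e \<in> X \<Longrightarrow> e \<in> arcs \<Gamma>"
  using partition by (auto simp: partition_on_def)

lemma (in separated_digraph) part_source_in_verts: "X \<in> P \<Longrightarrow> part_source \<Gamma> X \<in> verts \<Gamma>"
  using partition part_source_eq part_arcs tail_in_verts
  by (metis all_not_in_conv partition_onD3)

lemma lpa_gens_simps [simp]:
  "Vertex v \<in> lpa_gens \<Gamma> \<longleftrightarrow> v \<in> verts \<Gamma>"
  "Arrow e \<in> lpa_gens \<Gamma> \<longleftrightarrow> e \<in> arcs \<Gamma>"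
  "Star e \<in> lpa_gens \<Gamma> \<longleftrightarrow> e \<in> arcs \<Gamma>"
  by (auto simp: lpa_gens_def)

section \<open>The defining relations as identities between operators\<close>

locale lpa_module = finitely_separated_digraph \<Gamma> P +
    presented_module scale "lpa_gens \<Gamma>" "lpa_relations \<Gamma> P" M act
  for \<Gamma> :: "('v, 'e) pre_digraph" and P
    and scale :: "'f::field \<Rightarrow> 'm::ab_group_add \<Rightarrow> 'm" and M act
begin

text \<open>For a right action, \<open>aop e\<close> leads from the space at se to the space at te,
  and \<open>sop e\<close> leads back.\<close>

abbreviation "vop v \<equiv> rop (gen (Vertex v))"
abbreviation "aop e \<equiv> rop (gen (Arrow e))"
abbreviation "sop e \<equiv> rop (gen (Star e))"

context
  fixes m assumes m: "m \<in> M"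
begin

lemma vop_vop:
  assumes "v \<in> verts \<Gamma>" "w \<in> verts \<Gamma>"
  shows "vop w (vop v m) = (if v = w then vop v m else 0)"
proof -
  have "vop w (vop v m) = rop (gen (Vertex v) * gen (Vertex w)) m"
    using assms m by (simp add: rop_mult)
  also have "\<dots> = rop (if v = w then gen (Vertex v) else 0) m"
    by (rule rop_relation) (use assms in \<open>auto simp: lpa_relations_def\<close>)
  finally show ?thesis
    using m by (simp add: rop_0)
qed

lemma vop_target:
  assumes "e \<in> arcs \<Gamma>" "x = Arrow e \<or> x = Star e"
  shows "vop (gtarget \<Gamma> x) (rop (gen x) m) = rop (gen x) m"
proof -
  have *: "gen x \<in> free_algebra (lpa_gens \<Gamma>)" "gen (Vertex (gtarget \<Gamma> x)) \<in> free_algebra (lpa_gens \<Gamma>)"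
    using assms by auto
  then have "vop (gtarget \<Gamma> x) (rop (gen x) m) = rop (gen x * gen (Vertex (gtarget \<Gamma> x))) m"
    using m by (simp add: rop_mult)
  also have "\<dots> = rop (gen x) m"
    by (rule rop_relation) (use assms * in \<open>auto simp: lpa_relations_def\<close>)
  finally show ?thesis .
qed

lemma rop_source:
  assumes "e \<in> arcs \<Gamma>" "x = Arrow e \<or> x = Star e"
  shows "rop (gen x) (vop (gsource \<Gamma> x) m) = rop (gen x) m"
proof -
  have *: "gen x \<in> free_algebra (lpa_gens \<Gamma>)" "gen (Vertex (gsource \<Gamma> x)) \<in> free_algebra (lpa_gens \<Gamma>)"
    using assms by auto
  then have "rop (gen x) (vop (gsource \<Gamma> x) m) = rop (gen (Vertex (gsource \<Gamma> x)) * gen x) m"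
    using m by (simp add: rop_mult)
  also have "\<dots> = rop (gen x) m"
    by (rule rop_relation) (use assms * in \<open>auto simp: lpa_relations_def\<close>)
  finally show ?thesis .
qed

lemma aop_sop:
  assumes "X \<in> P" "e \<in> X" "f \<in> X"
  shows "aop f (sop e m) = (if e = f then vop (head \<Gamma> e) m else 0)"
proof -
  have arcs: "e \<in> arcs \<Gamma>" "f \<in> arcs \<Gamma>"
    using assms part_arcs by auto
  then have "aop f (sop e m) = rop (gen (Star e) * gen (Arrow f)) m"
    using m by (simp add: rop_mult)
  also have "\<dots> = rop (if e = f then gen (Vertex (head \<Gamma> e)) else 0) m"
    by (rule rop_relation) (use assms arcs in \<open>auto simp: lpa_relations_def\<close>)
  finally show ?thesis
    using m by (simp add: rop_0)
qed

lemma vop_part_source: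
  assumes "X \<in> P"
  shows "vop (part_source \<Gamma> X) m = (\<Sum>e\<in>X. sop e (aop e m))"
proof -
  have "vop (part_source \<Gamma> X) m = rop (\<Sum>e\<in>X. gen (Arrow e) * gen (Star e)) m"
  proof (rule rop_relation)
    show "gen (Vertex (part_source \<Gamma> X)) - (\<Sum>e\<in>X. gen (Arrow e) * gen (Star e))
        \<in> lpa_relations \<Gamma> P"
      unfolding lpa_relations_def by (rule UnI2) (use assms finite_part in blast)
  qed (simp_all add: part_arcs[OF assms] part_source_in_verts[OF assms])
  also have "\<dots> = (\<Sum>e\<in>X. sop e (aop e m))"
    using m part_arcs[OF assms] by (simp add: rop_sum rop_mult)
  finally show ?thesis .
qed

end

section \<open>Dimensions of the spaces at the vertices\<close>

abbreviation "corner v \<equiv> vop v ` M"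

lemma corner_closed: "v \<in> verts \<Gamma> \<Longrightarrow> m \<in> corner v \<Longrightarrow> m \<in> M"
  by (auto intro: rop_closed)

lemma vop_corner: "v \<in> verts \<Gamma> \<Longrightarrow> m \<in> corner v \<Longrightarrow> vop v m = m"
  by (auto simp: vop_vop)

text \<open>Guarantees that \<open>dim\<close> of a corner is a true dimension and not the
  cardinality 0 of an infinite basis.\<close>

lemma corner_basis_finite:
  assumes "finite_dim scale M" "v \<in> verts \<Gamma>" "independent B" "B \<subseteq> corner v"
  shows "finite B"
proof -
  obtain B0 where "finite B0" "M \<subseteq> span B0"
    using assms by (auto simp: finite_dim_def)
  then show ?thesis
    using assms independent_span_bound[of B0 B] corner_closed by blast
qed

text \<open>If \<open>B e\<close> is a basis of \<open>M te\<close> for \<open>e \<in> X\<close>, the products \<open>b e\<^sup>*\<close> form a basis of \<open>M sX\<close>.\<close>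

lemma dim_corner:
  assumes fin: "finite_dim scale M" and X: "X \<in> P"
  shows "dim (corner (part_source \<Gamma> X)) = (\<Sum>e\<in>X. dim (corner (head \<Gamma> e)))"
proof -
  have arcs: "e \<in> arcs \<Gamma>" "head \<Gamma> e \<in> verts \<Gamma>" if "e \<in> X" for e
    using part_arcs[OF X that] by auto
  have "\<exists>B. B \<subseteq> corner (head \<Gamma> e) \<and> independent B \<and> corner (head \<Gamma> e) \<subseteq> span B \<and>
      card B = dim (corner (head \<Gamma> e))" for e
    using basis_exists by metis
  then obtain B where B: "\<And>e. B e \<subseteq> corner (head \<Gamma> e)" "\<And>e. independent (B e)"
    "\<And>e. corner (head \<Gamma> e) \<subseteq> span (B e)" "\<And>e. card (B e) = dim (corner (head \<Gamma> e))"
    by metis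
  have finB: "finite (B e)" if "e \<in> X" for e
    using corner_basis_finite[OF fin] arcs[OF that] B by blast
  have BM: "B e \<subseteq> M" if "e \<in> X" for e
    using corner_closed B(1) arcs[OF that] by blast
  have vB: "vop (head \<Gamma> e) b = b" if "e \<in> X" "b \<in> B e" for e b
    by (rule vop_corner[OF arcs(2)[OF that(1)] subsetD[OF B(1) that(2)]])
  define h where "h = (\<lambda>(e, b). sop e b)"
  have hM: "h x \<in> M" if "x \<in> Sigma X B" for x
  proof -
    obtain e b where x: "x = (e, b)" "e \<in> X" "b \<in> B e"
      using \<open>x \<in> Sigma X B\<close> by blast
    then have "sop e b \<in> M"
      using arcs(1)[OF x(2)] subsetD[OF BM[OF x(2)] x(3)] by (intro rop_closed) simp_all
    then show ?thesis
      using x by (simp add: h_def)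
  qed
  \<comment> \<open>By (SCK1), \<open>aop f\<close> reads off the component at f. Injectivity and
    independence of the family \<open>h\<close> both rest on this.\<close>
  have aop_h: "aop f (h (e, b)) = (if e = f then b else 0)" if "e \<in> X" "f \<in> X" "b \<in> B e" for e f b
    using aop_sop[OF subsetD[OF BM[OF that(1)] that(3)] X that(1,2)] vB[OF that(1,3)]
    by (auto simp: h_def)
  have inj: "inj_on h (Sigma X B)"
  proof (rule inj_onI, clarify)
    fix e b f c assume *: "e \<in> X" "b \<in> B e" "f \<in> X" "c \<in> B f" "h (e, b) = h (f, c)"
    have "b = aop e (h (e, b))"
      unfolding aop_h[OF *(1,1,2)] by simp
    also have "\<dots> = (if f = e then c else 0)"
      unfolding *(5) by (rule aop_h[OF *(3,1,4)])
    finally have "b = (if f = e then c else 0)" .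
    \<comment> \<open>A basis vector is nonzero, which excludes the case of two different
      arrows.\<close>
    moreover have "b \<noteq> 0"
    proof
      assume "b = 0"
      with *(2) have "dependent (B e)"
        by (intro dependent_zero) simp
      with B(2) show False by blast
    qed
    ultimately show "e = f \<and> b = c" by presburger
  qed
  have finS: "finite (Sigma X B)"
    using finite_part[OF X] finB by blast
  have indep: "independent (h ` Sigma X B)"
  proof (rule independent_if_scalars_zero)
    show "finite (h ` Sigma X B)" using finS by simp
    fix u x assume sum0: "(\<Sum>x\<in>h ` Sigma X B. scale (u x) x) = 0" and "x \<in> h ` Sigma X B"
    then obtain f c where fc: "f \<in> X" "c \<in> B f" "x = h (f, c)" by auto
    have f: "gen (Arrow f) \<in> free_algebra (lpa_gens \<Gamma>)"
      using arcs fc by simp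
    \<comment> \<open>Applying \<open>aop f\<close> to the vanishing combination leaves only the
      block of f, which is a linear relation between the vectors of the basis
      \<open>B f\<close>.\<close>
    have "(\<Sum>b\<in>B f. scale (u (h (f, b))) b)
        = (\<Sum>e\<in>X. if e = f then \<Sum>b\<in>B f. scale (u (h (f, b))) b else 0)"
      using finite_part[OF X] fc(1) by simp
    also have "\<dots> = (\<Sum>e\<in>X. \<Sum>b\<in>B e. scale (u (h (e, b))) (aop f (h (e, b))))"
      using fc by (intro sum.cong refl) (auto simp: aop_h)
    also have "\<dots> = (\<Sum>x\<in>Sigma X B. scale (u (h x)) (aop f (h x)))"
      using finite_part[OF X] finB by (subst sum.Sigma) (auto intro!: sum.cong)
    also have "\<dots> = aop f (\<Sum>x\<in>Sigma X B. scale (u (h x)) (h x))"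
      using f hM by (simp add: rop_vec_sum rop_vec_scale subspace_scale[OF subspace_M])
    also have "\<dots> = 0"
      using sum0 f by (simp add: sum.reindex[OF inj] rop_vec_0)
    finally have "(\<Sum>b\<in>B f. scale (u (h (f, b))) b) = 0" .
    then show "u x = 0"
      using independentD[OF B(2) finB[OF fc(1)] subset_refl, where u = "\<lambda>b. u (h (f, b))" and v = c] fc
      by simp
  qed
  \<comment> \<open>(SCK2) writes a vector at sX as a sum of images under \<open>sop e\<close> of
    vectors at te, each of which is expanded in \<open>B e\<close>.\<close>
  have "corner (part_source \<Gamma> X) \<subseteq> span (h ` Sigma X B)"
  proof clarify
    fix m assume m: "m \<in> M"
    have "sop e (aop e m) \<in> span (h ` Sigma X B)" if e: "e \<in> X" for e
    proof -
      have "aop e m = vop (head \<Gamma> e) (aop e m)"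
        using vop_target[OF m arcs(1)[OF e], of "Arrow e"] by simp
      then have "aop e m \<in> corner (head \<Gamma> e)"
        using m arcs[OF e] rop_closed by (metis gen_in_free_algebra imageI lpa_gens_simps(2))
      then have "sop e (aop e m) \<in> span (sop e ` B e)"
        using B(3) BM[OF e] arcs[OF e] by (intro rop_image_span) auto
      also have "\<dots> \<subseteq> span (h ` Sigma X B)"
        using e by (intro span_mono) (auto simp: h_def image_iff)
      finally show ?thesis .
    qed
    then show "vop (part_source \<Gamma> X) m \<in> span (h ` Sigma X B)"
      using vop_part_source[OF m X] by (simp add: span_sum)
  qed
  \<comment> \<open>The target of \<open>Star e\<close> is se = sX, so (E) places its image in the
    corner at sX.\<close>
  moreover have "h ` Sigma X B \<subseteq> corner (part_source \<Gamma> X)"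
  proof clarify
    fix e b assume e: "e \<in> X" and b: "b \<in> B e"
    have "h (e, b) = vop (part_source \<Gamma> X) (h (e, b))"
      using vop_target[of b e "Star e"] part_source_eq[OF X e] BM[OF e] b arcs[OF e]
      by (auto simp: h_def)
    then show "h (e, b) \<in> corner (part_source \<Gamma> X)"
      using hM e b by blast
  qed
  ultimately have "dim (corner (part_source \<Gamma> X)) = card (h ` Sigma X B)"
    using indep by (intro dim_unique) auto
  also have "\<dots> = (\<Sum>e\<in>X. dim (corner (head \<Gamma> e)))"
    using finite_part[OF X] finB by (simp add: card_image[OF inj] B(4))
  finally show ?thesis .
qed

text \<open>By (V) the vertex operators are orthogonal projections, so nonzero vectors chosen from
  different corners are independent. Hence every finite subset of the support is at most as large as
  a finite spanning set of \<open>M\<close>.\<close>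

lemma finite_corner_support:
  assumes "finite_dim scale M"
  shows "finite {v \<in> verts \<Gamma>. dim (corner v) \<noteq> 0}"
proof -
  obtain B0 where B0: "finite B0" "M \<subseteq> span B0"
    using assms by (auto simp: finite_dim_def)
  have "\<exists>b. b \<in> corner v \<and> b \<noteq> 0" if "dim (corner v) \<noteq> 0" for v
    using that dim_le_card[of "corner v" "{}"] by auto
  then obtain b where b: "\<And>v. dim (corner v) \<noteq> 0 \<Longrightarrow> b v \<in> corner v \<and> b v \<noteq> 0"
    by metis
  have "finite F \<Longrightarrow> card F \<le> card B0" if F: "F \<subseteq> {v \<in> verts \<Gamma>. dim (corner v) \<noteq> 0}" for F
  proof -
    assume fin: "finite F"
    have bM: "b v \<in> M" if "v \<in> F" for v
      using b F that corner_closed by blast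
    have vop_b: "vop w (b v) = (if v = w then b v else 0)" if "v \<in> F" "w \<in> F" for v w
    proof -
      have v: "v \<in> verts \<Gamma>" "w \<in> verts \<Gamma>" "b v \<in> corner v" using F that b by auto
      then show ?thesis
        using vop_vop[OF bM[OF that(1)] v(1,2)] vop_corner[OF v(1,3)] by auto
    qed
    have inj: "inj_on b F"
    proof (rule inj_onI, rule ccontr)
      fix v w assume *: "v \<in> F" "w \<in> F" "b v = b w" "v \<noteq> w"
      then have "b w = 0"
        using vop_b[of v w] vop_b[of w w] by simp
      then show False
        using b[of w] F *(2) by auto
    qed
    have "independent (b ` F)"
    proof (rule independent_if_scalars_zero)
      show "finite (b ` F)" using fin by simp
      fix u x assume sum0: "(\<Sum>x\<in>b ` F. scale (u x) x) = 0" and "x \<in> b ` F"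
      then obtain w where w: "w \<in> F" "x = b w" by auto
      have g: "gen (Vertex w) \<in> free_algebra (lpa_gens \<Gamma>)"
        using F w by auto
      \<comment> \<open>Applying \<open>vop w\<close> to the vanishing combination isolates the term
        of \<open>b w\<close>.\<close>
      have "scale (u x) x = (\<Sum>v\<in>F. if v = w then scale (u x) x else 0)"
        using fin w by simp
      also have "\<dots> = (\<Sum>v\<in>F. scale (u (b v)) (vop w (b v)))"
        using w by (intro sum.cong) (auto simp: vop_b)
      also have "\<dots> = vop w (\<Sum>v\<in>F. scale (u (b v)) (b v))"
        using g bM by (simp add: rop_vec_sum rop_vec_scale subspace_scale[OF subspace_M])
      also have "\<dots> = 0"
        using sum0 g by (simp add: sum.reindex[OF inj] rop_vec_0)
      finally show "u x = 0"
        using w b F by auto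
    qed
    moreover have "b ` F \<subseteq> span B0"
      using bM B0 by blast
    ultimately have "card (b ` F) \<le> card B0"
      using independent_span_bound[OF B0(1)] by blast
    then show ?thesis by (simp add: card_image[OF inj])
  qed
  then show ?thesis
    using finite_if_finite_subsets_card_bdd by blast
qed

text \<open>If all corners had dimension 0, every vertex would act as zero. By (V) and (E) each
  generator absorbs its source vertex, so it would act as zero too, which forces \<open>M\<close> to
  be trivial.\<close>

lemma corner_support_nonempty:
  assumes "finite_dim scale M" "M \<noteq> {0}"
  shows "{v \<in> verts \<Gamma>. dim (corner v) \<noteq> 0} \<noteq> {}"
proof
  assume empty: "{v \<in> verts \<Gamma>. dim (corner v) \<noteq> 0} = {}"
  have vop0: "vop v m = 0" if v: "v \<in> verts \<Gamma>" and m: "m \<in> M" for v m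
  proof -
    obtain B where B: "B \<subseteq> corner v" "independent B" "corner v \<subseteq> span B"
      "card B = dim (corner v)"
      using basis_exists by metis
    have "card B = 0"
      using B(4) empty v by simp
    then have "B = {}"
      using corner_basis_finite[OF assms(1) v B(2,1)] by simp
    then have "corner v \<subseteq> {0}"
      using B(3) by simp
    then show ?thesis
      using m by blast
  qed
  have "rop (gen g) m = 0" if "g \<in> lpa_gens \<Gamma>" "m \<in> M" for g m
  proof -
    have g: "gsource \<Gamma> g \<in> verts \<Gamma>"
      using that(1) by (cases g) simp_all
    have "rop (gen g) (vop (gsource \<Gamma> g) m) = rop (gen g) m"
      using that(1) vop_vop[OF that(2)] rop_source[OF that(2), of _ g] by (cases g) simp_all
    with g show ?thesis
      using vop0[of "gsource \<Gamma> g" m] rop_vec_0[of "gen g"] that by simp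
  qed
  then show False
    using trivial_if_generators_act_trivially assms(2) by blast
qed

lemma dimension_function_of_module:
  assumes "finite_dim scale M" "M \<noteq> {0}"
  shows "\<exists>d. dimension_function \<Gamma> P d \<and> dim_support \<Gamma> d \<noteq> {} \<and> finite (dim_support \<Gamma> d)"
proof (intro exI conjI)
  show "dimension_function \<Gamma> P (\<lambda>v. dim (corner v))"
    using dim_corner[OF assms(1)] by (simp add: dimension_function_def)
qed (use finite_corner_support[OF assms(1)] corner_support_nonempty[OF assms]
    in \<open>simp_all only: dim_support_def not_False_eq_True\<close>)

end

section \<open>The module of a dimension function\<close>

abbreviation unit_vec :: "'k \<Rightarrow> ('k \<Rightarrow>\<^sub>0 'f::field)" where
  "unit_vec k \<equiv> Poly_Mapping.single k 1"

lemma inj_unit_vec: "inj_on unit_vec K"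
  by (rule inj_onI) (metis keys_single one_neq_zero singleton_inject)

lemma independent_unit_vecs:
  fixes K :: "'k set"
  assumes "finite K"
  shows "pm.independent (unit_vec ` K :: ('k \<Rightarrow>\<^sub>0 'f::field) set)"
proof (rule pm.independent_if_scalars_zero)
  fix u :: "('k \<Rightarrow>\<^sub>0 'f) \<Rightarrow> 'f" and x :: "'k \<Rightarrow>\<^sub>0 'f"
  assume sum0: "(\<Sum>x\<in>unit_vec ` K. pm_scale (u x) x) = 0" and "x \<in> unit_vec ` K"
  then obtain k where k: "k \<in> K" "x = unit_vec k" by auto
  have "u x = (\<Sum>j\<in>K. if j = k then u (unit_vec j) else 0)"
    using assms k by simp
  also have "\<dots> = Poly_Mapping.lookup (\<Sum>j\<in>K. pm_scale (u (unit_vec j)) (unit_vec j)) k"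
    unfolding lookup_sum by (intro sum.cong) (simp_all add: lookup_single when_def)
  also have "\<dots> = 0"
    using sum0 by (simp add: sum.reindex[OF inj_unit_vec])
  finally show "u x = 0" .
qed (use assms in simp)

lemma span_unit_vecs:
  fixes K :: "'k set"
  shows "pm.span (unit_vec ` K) = {p :: 'k \<Rightarrow>\<^sub>0 'f::field. Poly_Mapping.keys p \<subseteq> K}"
proof
  have "{p :: 'k \<Rightarrow>\<^sub>0 'f. Poly_Mapping.keys p \<subseteq> K}
      = {p. \<forall>k. k \<notin> K \<longrightarrow> Poly_Mapping.lookup p k = 0}"
    by (auto simp: in_keys_iff)
  then have "pm.subspace {p :: 'k \<Rightarrow>\<^sub>0 'f. Poly_Mapping.keys p \<subseteq> K}"
    by (auto simp: lookup_add intro: pm.subspaceI)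
  then show "pm.span (unit_vec ` K) \<subseteq> {p :: 'k \<Rightarrow>\<^sub>0 'f. Poly_Mapping.keys p \<subseteq> K}"
    by (intro pm.span_minimal) auto
  show "{p :: 'k \<Rightarrow>\<^sub>0 'f. Poly_Mapping.keys p \<subseteq> K} \<subseteq> pm.span (unit_vec ` K)"
  proof clarify
    fix p :: "'k \<Rightarrow>\<^sub>0 'f" assume "Poly_Mapping.keys p \<subseteq> K"
    then have "(\<Sum>k\<in>Poly_Mapping.keys p. pm_scale (Poly_Mapping.lookup p k) (unit_vec k))
        \<in> pm.span (unit_vec ` K)"
      by (intro pm.span_sum pm.span_scale pm.span_base) auto
    then show "p \<in> pm.span (unit_vec ` K)"
      using poly_mapping_eq_sum_single[of p] by simp
  qed
qed

section \<open>Operators built from bijections between bases\<close>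

context finitely_separated_digraph
begin

text \<open>The type \<open>'a\<close> is that of vertices and \<open>'b\<close> that of arrows. The
  bijections and the map from an arrow to its part stay fixed here; they are obtained from
  \<open>d\<close> in \<open>module_of_dimension_function\<close>.\<close>

context
  fixes d :: "'a \<Rightarrow> nat" and \<phi> :: "'b set \<Rightarrow> 'b \<times> nat \<Rightarrow> nat" and part :: "'b \<Rightarrow> 'b set"
  assumes bij: "\<And>X. X \<in> P \<Longrightarrow>
      bij_betw (\<phi> X) (SIGMA e:X. {..<d (head \<Gamma> e)}) {..<d (part_source \<Gamma> X)}"
    and part: "\<And>X e. X \<in> P \<Longrightarrow> e \<in> X \<Longrightarrow> part e = X"
begin

text \<open>Splits a basis index at sX into the arrow whose summand it belongs to and its index at
  the target of that arrow.\<close>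

definition \<psi> :: "'b set \<Rightarrow> nat \<Rightarrow> 'b \<times> nat" where
  "\<psi> X = inv_into (SIGMA e:X. {..<d (head \<Gamma> e)}) (\<phi> X)"

text \<open>
  The action on the basis \<open>(v, i)\<close>, \<open>i < d v\<close>: for each part \<open>X\<close> the bijection \<open>\<phi> X\<close>
  identifies the basis at \<open>sX\<close> with the disjoint union of the bases at \<open>te\<close>, \<open>e \<in> X\<close>;
  \<open>e\<^sup>*\<close> is the inclusion of the \<open>e\<close>-th summand and \<open>e\<close> is the projection onto it.
\<close>

primrec basis_act :: "('a, 'b) lpa_gen \<Rightarrow> 'a \<times> nat \<Rightarrow> ('a \<times> nat \<Rightarrow>\<^sub>0 'f::field)" where
  "basis_act (Vertex v) k =
     (if v \<in> verts \<Gamma> \<and> fst k = v \<and> snd k < d v then unit_vec k else 0)"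
| "basis_act (Arrow e) k =
     (if e \<in> arcs \<Gamma> \<and> fst k = tail \<Gamma> e \<and> snd k < d (tail \<Gamma> e) \<and> fst (\<psi> (part e) (snd k)) = e
      then unit_vec (head \<Gamma> e, snd (\<psi> (part e) (snd k))) else 0)"
| "basis_act (Star e) k =
     (if e \<in> arcs \<Gamma> \<and> fst k = head \<Gamma> e \<and> snd k < d (head \<Gamma> e)
      then unit_vec (tail \<Gamma> e, \<phi> (part e) (e, snd k)) else 0)"

lemma \<phi>_less: "X \<in> P \<Longrightarrow> e \<in> X \<Longrightarrow> j < d (head \<Gamma> e) \<Longrightarrow> \<phi> X (e, j) < d (tail \<Gamma> e)"
  using bij_betwE[OF bij, of X] part_source_eq[of X e] by auto

lemma \<psi>_\<phi>: "X \<in> P \<Longrightarrow> e \<in> X \<Longrightarrow> j < d (head \<Gamma> e) \<Longrightarrow> \<psi> X (\<phi> X (e, j)) = (e, j)"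
  unfolding \<psi>_def by (intro bij_betw_inv_into_left[OF bij]) auto

lemma \<phi>_\<psi>: "X \<in> P \<Longrightarrow> i < d (part_source \<Gamma> X) \<Longrightarrow> \<phi> X (\<psi> X i) = i"
  unfolding \<psi>_def by (intro bij_betw_inv_into_right[OF bij]) auto

lemma \<psi>_in: "X \<in> P \<Longrightarrow> i < d (part_source \<Gamma> X) \<Longrightarrow>
    fst (\<psi> X i) \<in> X \<and> snd (\<psi> X i) < d (head \<Gamma> (fst (\<psi> X i)))"
  using bij_betwE[OF bij_betw_inv_into[OF bij], of X] unfolding \<psi>_def[symmetric]
  by (cases "\<psi> X i") force

lemma part_of_arc: "e \<in> arcs \<Gamma> \<Longrightarrow> part e \<in> P \<and> e \<in> part e"
  using partition part unfolding partition_on_def by blast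

text \<open>Arrows send valid indices to valid indices. Both the target half of (E) and the
  invariance of the module rely on this.\<close>

lemma arc_\<psi>_less:
  assumes "e \<in> arcs \<Gamma>" "i < d (tail \<Gamma> e)" "fst (\<psi> (part e) i) = e"
  shows "snd (\<psi> (part e) i) < d (head \<Gamma> e)"
  using \<psi>_in[of "part e" i] part_of_arc[OF assms(1)] part_source_eq[of "part e" e] assms
  by simp

lemma arc_\<phi>_less:
  assumes "e \<in> arcs \<Gamma>" "j < d (head \<Gamma> e)"
  shows "\<phi> (part e) (e, j) < d (tail \<Gamma> e)"
  using \<phi>_less part_of_arc assms by blast

definition gen_act :: "('a, 'b) lpa_gen \<Rightarrow> ('a \<times> nat \<Rightarrow>\<^sub>0 'f) \<Rightarrow> ('a \<times> nat \<Rightarrow>\<^sub>0 'f::field)" where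
  "gen_act g = lin_ext pm_scale (basis_act g)"

lemma linear_gen_act: "Vector_Spaces.linear pm_scale pm_scale (gen_act g)"
  unfolding gen_act_def by (rule pm.linear_lin_ext)

lemma gen_act_unit_vec [simp]: "gen_act g (unit_vec k) = basis_act g k"
  by (simp add: gen_act_def del: map_single)

lemma gen_act_0 [simp]: "gen_act g 0 = 0"
  by (simp add: gen_act_def lin_ext_def)

text \<open>By linearity it suffices to test unit vectors. (V) and (E) come from the index
  conditions in \<open>basis_act\<close>; (SCK1) holds because \<open>\<psi> X\<close> undoes
  \<open>\<phi> X\<close>, and (SCK2) because \<open>\<phi> X\<close> undoes
  \<open>\<psi> X\<close>. On invalid indices all generators vanish, so the relations hold on the
  whole ambient space.\<close>

lemma relations_act_as_zero:
  assumes "r \<in> lpa_relations \<Gamma> P"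
  shows "eval_rep pm_scale gen_act r (m :: 'a \<times> nat \<Rightarrow>\<^sub>0 'f::field) = 0"
proof -
  let ?E = "eval_rep pm_scale (gen_act :: _ \<Rightarrow> ('a \<times> nat \<Rightarrow>\<^sub>0 'f) \<Rightarrow> _)"
  interpret E: Vector_Spaces.linear pm_scale pm_scale "\<lambda>p. ?E p n" for n
    by (rule pm.linear_eval_rep)
  have mult: "?E (gen g * gen h) n = gen_act h (gen_act g n)" for g h n
    by (simp add: pm.eval_rep_mult[OF linear_gen_act])
  have basis: "?E r (unit_vec k) = 0" for k
    using assms unfolding lpa_relations_def
  proof (elim UnE)
    assume "r \<in> {gen (Vertex v) * gen (Vertex w) - (if v = w then gen (Vertex v) else 0) | v w.
        v \<in> verts \<Gamma> \<and> w \<in> verts \<Gamma>}"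
    then show ?thesis by (auto simp: E.diff E.zero mult)
  next
    assume "r \<in> (\<Union>x \<in> Arrow ` arcs \<Gamma> \<union> Star ` arcs \<Gamma>.
        {gen (Vertex (gsource \<Gamma> x)) * gen x - gen x,
         gen x * gen (Vertex (gtarget \<Gamma> x)) - gen x})"
    then show ?thesis
      by (auto simp: E.diff mult arc_\<psi>_less arc_\<phi>_less)
  next
    assume "r \<in> {gen (Star e) * gen (Arrow f) - (if e = f then gen (Vertex (head \<Gamma> e)) else 0)
        | e f X. X \<in> P \<and> e \<in> X \<and> f \<in> X}"
    then obtain e f X where r: "r = gen (Star e) * gen (Arrow f) -
        (if e = f then gen (Vertex (head \<Gamma> e)) else 0)" and X: "X \<in> P" "e \<in> X" "f \<in> X"
      by blast
    have tail: "tail \<Gamma> f = tail \<Gamma> e"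
      by (rule same_source[OF X(1,3,2)])
    have arcs: "e \<in> arcs \<Gamma>" "f \<in> arcs \<Gamma>" "part e = X" "part f = X"
      using X part_arcs part by blast+
    \<comment> \<open>Index j at te is sent to \<open>\<phi> X (e, j)\<close> at sX, from which
      \<open>\<psi> X\<close> recovers e and j. Thus f moves it back if f = e and kills it
      otherwise.\<close>
    have "gen_act (Arrow f) (basis_act (Star e) k) =
        (if e = f then basis_act (Vertex (head \<Gamma> e)) k else (0 :: _ \<Rightarrow>\<^sub>0 'f))"
    proof (cases "fst k = head \<Gamma> e \<and> snd k < d (head \<Gamma> e)")
      case True
      then have k: "k = (head \<Gamma> e, snd k)" and j: "snd k < d (head \<Gamma> e)"
        by (simp_all add: prod_eq_iff)
      have "basis_act (Star e) k = (unit_vec (tail \<Gamma> e, \<phi> X (e, snd k)) :: _ \<Rightarrow>\<^sub>0 'f)"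
        using True arcs by simp
      then have "gen_act (Arrow f) (basis_act (Star e) k) =
          (basis_act (Arrow f) (tail \<Gamma> e, \<phi> X (e, snd k)) :: _ \<Rightarrow>\<^sub>0 'f)"
        by (simp only: gen_act_unit_vec)
      also have "\<dots> = (if e = f then unit_vec (head \<Gamma> e, snd k) else 0)"
        unfolding basis_act.simps fst_conv snd_conv arcs tail \<psi>_\<phi>[OF X(1,2) j]
        using arcs(2) \<phi>_less[OF X(1,2) j] by simp
      also have "\<dots> = (if e = f then basis_act (Vertex (head \<Gamma> e)) k else 0)"
        using True arcs(1) by (cases k) auto
      finally show ?thesis .
    next
      case False
      then have "basis_act (Star e) k = (0 :: _ \<Rightarrow>\<^sub>0 'f)"
        "basis_act (Vertex (head \<Gamma> e)) k = (0 :: _ \<Rightarrow>\<^sub>0 'f)"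
        by auto
      then show ?thesis
        by (cases "e = f") (simp_all del: basis_act.simps)
    qed
    then show ?thesis
      by (cases "e = f") (simp_all add: r E.diff mult del: basis_act.simps)
  next
    assume "r \<in> {gen (Vertex (part_source \<Gamma> X)) - (\<Sum>e\<in>X. gen (Arrow e) * gen (Star e)) | X.
        X \<in> P \<and> finite X}"
    then obtain X where r: "r = gen (Vertex (part_source \<Gamma> X)) -
        (\<Sum>e\<in>X. gen (Arrow e) * gen (Star e))" and X: "X \<in> P" "finite X"
      by blast
    obtain w i where k: "k = (w, i)" by (cases k)
    have arcs: "e \<in> arcs \<Gamma>" "tail \<Gamma> e = part_source \<Gamma> X" "part e = X" if "e \<in> X" for e
      using part_arcs part_source_eq part X that by auto
    \<comment> \<open>A valid index i at sX survives under exactly one arrow of \<open>X\<close>,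
      the first component of \<open>\<psi> X i\<close>, and the star of that arrow takes it back to
      i. For any other index all terms vanish.\<close>
    have "(\<Sum>e\<in>X. gen_act (Star e) (basis_act (Arrow e) k)) =
        (basis_act (Vertex (part_source \<Gamma> X)) k :: _ \<Rightarrow>\<^sub>0 'f)"
    proof (cases "w = part_source \<Gamma> X \<and> i < d w")
      case True
      then have w: "w = part_source \<Gamma> X" "i < d (part_source \<Gamma> X)" by auto
      have "(\<Sum>e\<in>X. gen_act (Star e) (basis_act (Arrow e) k)) =
          (\<Sum>e\<in>X. if e = fst (\<psi> X i) then unit_vec k else (0 :: _ \<Rightarrow>\<^sub>0 'f))"
        using True \<psi>_in[OF X(1)] \<phi>_\<psi>[OF X(1), of i] arcs
        by (intro sum.cong refl) (auto simp: k)
      also have "\<dots> = unit_vec k"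
        using X(2) \<psi>_in[OF X(1) w(2)] by simp
      also have "\<dots> = basis_act (Vertex (part_source \<Gamma> X)) k"
        using w part_source_in_verts[OF X(1)] by (simp add: k)
      finally show ?thesis .
    next
      case False
      then show ?thesis
        using arcs by (auto simp: k intro!: sum.neutral)
    qed
    then show ?thesis
      by (simp add: r E.diff E.sum mult del: basis_act.simps)
  qed
  interpret V: Vector_Spaces.linear pm_scale pm_scale "?E r"
    by (rule pm.linear_eval_rep_vector[OF linear_gen_act])
  show ?thesis
    by (subst poly_mapping_eq_sum_single[of m]) (simp add: V.sum V.scale basis del: map_single)
qed

text \<open>The valid indices (v, i) with i < d v give a basis of the module, and those over a fixed
  vertex give a basis of its corner. The explicit form of \<open>M\<close> serves to decide later
  whether it is nonzero and finite dimensional.\<close>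

lemma module_of_bijections:
  obtains M and act :: "('a \<times> nat \<Rightarrow>\<^sub>0 'f::field) \<Rightarrow> _ \<Rightarrow> _"
  where "unital_right_module pm_scale (leavitt_path_algebra \<Gamma> P) M act"
    and "M = {p. Poly_Mapping.keys p \<subseteq> (SIGMA v:verts \<Gamma>. {..<d v})}"
    and "\<And>v. v \<in> verts \<Gamma> \<Longrightarrow>
      has_dim pm_scale ((\<lambda>m. act m (lpa_vertex \<Gamma> P v)) ` M) (d v)"
proof -
  define K where "K = (SIGMA v:verts \<Gamma>. {..<d v})"
  define M :: "('a \<times> nat \<Rightarrow>\<^sub>0 'f) set" where "M = pm.span (unit_vec ` K)"
  have M: "M = {p. Poly_Mapping.keys p \<subseteq> K}"
    by (simp add: M_def span_unit_vecs)
  have basis_act: "basis_act g k \<in> M" for g k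
  proof (cases g)
    case (Arrow e)
    then show ?thesis
      by (auto simp: M K_def arc_\<psi>_less)
  next
    case (Star e)
    then show ?thesis
      by (auto simp: M K_def arc_\<phi>_less)
  qed (cases k; auto simp: M K_def)
  have gen_act: "gen_act g m \<in> M" for g m
    unfolding gen_act_def lin_ext_def M_def
    by (intro pm.span_sum pm.span_scale) (use basis_act M_def in blast)
  \<comment> \<open>The vertices alone suffice: each basis vector is fixed by its own
    vertex.\<close>
  have unital: "M \<subseteq> pm.span {gen_act g m | g m. g \<in> lpa_gens \<Gamma> \<and> m \<in> M}"
    unfolding M_def
  proof (rule pm.span_mono, clarify)
    fix v i assume "(v, i) \<in> K"
    then have "unit_vec (v, i) = (gen_act (Vertex v) (unit_vec (v, i)) :: _ \<Rightarrow>\<^sub>0 'f)"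
      "Vertex v \<in> lpa_gens \<Gamma>" "unit_vec (v, i) \<in> pm.span (unit_vec ` K)"
      by (auto simp: K_def intro: pm.span_base)
    then show "\<exists>g m. unit_vec (v, i) = (gen_act g m :: _ \<Rightarrow>\<^sub>0 'f) \<and> g \<in> lpa_gens \<Gamma> \<and>
        m \<in> pm.span (unit_vec ` K)"
      by blast
  qed
  have "pm.subspace M"
    by (simp add: M_def)
  then obtain act where act:
    "unital_right_module pm_scale (presented_algebra (lpa_gens \<Gamma>) (lpa_relations \<Gamma> P)) M act"
    "\<And>p m. p \<in> free_algebra (lpa_gens \<Gamma>) \<Longrightarrow>
      act m (residue (lpa_gens \<Gamma>) (lpa_relations \<Gamma> P) p) = eval_rep pm_scale gen_act p m"
    using pm.module_of_representation[OF linear_gen_act relations_act_as_zero _ gen_act unital]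
    by metis
  have "has_dim pm_scale ((\<lambda>m. act m (lpa_vertex \<Gamma> P v)) ` M) (d v)" if v: "v \<in> verts \<Gamma>" for v
  proof -
    have "act m (lpa_vertex \<Gamma> P v) = gen_act (Vertex v) m" for m
      using act(2)[of "gen (Vertex v)" m] v by (simp add: lpa_vertex_def residue_def)
    then have image: "(\<lambda>m. act m (lpa_vertex \<Gamma> P v)) ` M = gen_act (Vertex v) ` M"
      by simp
    define B :: "('a \<times> nat \<Rightarrow>\<^sub>0 'f) set" where "B = unit_vec ` ({v} \<times> {..<d v})"
    have "basis_act (Vertex v) k \<in> pm.span B" for k
      by (cases k) (auto simp: B_def intro: pm.span_base pm.span_zero)
    then have sub: "gen_act (Vertex v) ` M \<subseteq> pm.span B"
      by (auto simp: gen_act_def lin_ext_def simp del: basis_act.simps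
          intro!: pm.span_sum pm.span_scale)
    have "B \<subseteq> gen_act (Vertex v) ` M"
    proof
      fix b assume "b \<in> B"
      then have "b = gen_act (Vertex v) b" "b \<in> M"
        using v by (auto simp: B_def M K_def)
      then show "b \<in> gen_act (Vertex v) ` M" by blast
    qed
    moreover have "pm.independent B" "card B = d v"
      by (simp_all add: B_def independent_unit_vecs card_image[OF inj_unit_vec])
    ultimately have "pm.dim (gen_act (Vertex v) ` M) = d v"
      using sub by (intro pm.dim_unique)
    moreover have "finite B"
      by (simp add: B_def)
    ultimately show ?thesis
      using sub unfolding has_dim_def finite_dim_def image by blast
  qed
  with act(1) M show thesis
    using that unfolding leavitt_path_algebra_def K_def by blast
qed

end

text \<open>The dimension equation at \<open>X\<close> says that the finite index set at sX and the
  disjoint union of those at the targets have equal cardinality, which yields the required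
  bijection.\<close>

lemma module_of_dimension_function:
  assumes d: "dimension_function \<Gamma> P d"
  obtains M and act :: "('a \<times> nat \<Rightarrow>\<^sub>0 'f::field) \<Rightarrow> _ \<Rightarrow> _"
  where "unital_right_module pm_scale (leavitt_path_algebra \<Gamma> P) M act"
    and "M = {p. Poly_Mapping.keys p \<subseteq> (SIGMA v:verts \<Gamma>. {..<d v})}"
    and "\<And>v. v \<in> verts \<Gamma> \<Longrightarrow>
      has_dim pm_scale ((\<lambda>m. act m (lpa_vertex \<Gamma> P v)) ` M) (d v)"
proof -
  have "\<exists>f. bij_betw f (SIGMA e:X. {..<d (head \<Gamma> e)}) {..<d (part_source \<Gamma> X)}"
    if "X \<in> P" for X
    using finite_part[OF that] d that
    by (intro finite_same_card_bij) (auto simp: dimension_function_def)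
  then obtain \<phi> where \<phi>: "\<And>X. X \<in> P \<Longrightarrow>
      bij_betw (\<phi> X) (SIGMA e:X. {..<d (head \<Gamma> e)}) {..<d (part_source \<Gamma> X)}"
    by metis
  \<comment> \<open>The parts are disjoint, so an arrow determines the part containing it.\<close>
  define part where "part e = (THE X. X \<in> P \<and> e \<in> X)" for e
  have "part e = X" if "X \<in> P" "e \<in> X" for X e
    unfolding part_def using partition_onD2[OF partition] that
    by (intro the_equality) (auto dest: disjointD)
  from module_of_bijections[of \<phi> d part, OF \<phi> this] that show thesis
    by blast
qed

end

section \<open>Finite dimensional modules versus dimension functions of finite support\<close>

lemma lpa_moduleI:
  assumes "finitely_separated_digraph \<Gamma> P"
    and "unital_right_module scale (leavitt_path_algebra \<Gamma> P) M act"
  shows "lpa_module \<Gamma> P scale M act"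
  using assms by (simp add: lpa_module_def presented_module_def leavitt_path_algebra_def)

text \<open>Types cannot be quantified, so the equivalence fixes one ambient space large enough for
  the construction. The last conjunct extends the passage from modules to dimension functions to an
  arbitrary ambient type.\<close>

theorem corollary3p9:
  fixes \<Gamma> :: "('v, 'e) pre_digraph" and P :: "'e set set"
  assumes "finitely_separated_digraph \<Gamma> P"
  shows
    "(\<forall>d. dimension_function \<Gamma> P d \<longrightarrow>
        (\<exists>(scale :: 'f::field \<Rightarrow> ('v \<times> nat \<Rightarrow>\<^sub>0 'f) \<Rightarrow> _) M act.
           unital_right_module scale (leavitt_path_algebra \<Gamma> P) M act \<and>
           (\<forall>v\<in>verts \<Gamma>. has_dim scale ((\<lambda>m. act m (lpa_vertex \<Gamma> P v)) ` M) (d v))))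
     \<and>
     ((\<exists>(scale :: 'f \<Rightarrow> ('v \<times> nat \<Rightarrow>\<^sub>0 'f) \<Rightarrow> _) M act.
         unital_right_module scale (leavitt_path_algebra \<Gamma> P) M act \<and>
         M \<noteq> {0} \<and> finite_dim scale M)
      \<longleftrightarrow>
      (\<exists>d. dimension_function \<Gamma> P d \<and> dim_support \<Gamma> d \<noteq> {} \<and> finite (dim_support \<Gamma> d)))
     \<and>
     (\<forall>(scale :: 'f \<Rightarrow> 'm::ab_group_add \<Rightarrow> 'm) M act.
         unital_right_module scale (leavitt_path_algebra \<Gamma> P) M act \<and>
         M \<noteq> {0} \<and> finite_dim scale M
      \<longrightarrow>
      (\<exists>d. dimension_function \<Gamma> P d \<and> dim_support \<Gamma> d \<noteq> {} \<and> finite (dim_support \<Gamma> d)))"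
proof -
  interpret finitely_separated_digraph \<Gamma> P by fact
  show ?thesis
  proof (intro conjI allI impI iffI)
    fix d assume "dimension_function \<Gamma> P d"
    then show "\<exists>(scale :: 'f \<Rightarrow> ('v \<times> nat \<Rightarrow>\<^sub>0 'f) \<Rightarrow> _) M act.
        unital_right_module scale (leavitt_path_algebra \<Gamma> P) M act \<and>
        (\<forall>v\<in>verts \<Gamma>. has_dim scale ((\<lambda>m. act m (lpa_vertex \<Gamma> P v)) ` M) (d v))"
      by (rule module_of_dimension_function[where 'f = 'f]) blast
  next
    assume "\<exists>d. dimension_function \<Gamma> P d \<and> dim_support \<Gamma> d \<noteq> {} \<and> finite (dim_support \<Gamma> d)"
    then obtain d where d: "dimension_function \<Gamma> P d" "dim_support \<Gamma> d \<noteq> {}"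
      "finite (dim_support \<Gamma> d)"
      by blast
    define K where "K = (SIGMA v:verts \<Gamma>. {..<d v})"
    obtain M and act :: "('v \<times> nat \<Rightarrow>\<^sub>0 'f) \<Rightarrow> _ \<Rightarrow> _"
      where M: "unital_right_module pm_scale (leavitt_path_algebra \<Gamma> P) M act"
        "M = {p. Poly_Mapping.keys p \<subseteq> K}"
      by (rule module_of_dimension_function[OF d(1), where 'f = 'f]) (auto simp: K_def)
    \<comment> \<open>Vertices outside the support contribute no index, so a finite support makes
      the basis finite.\<close>
    have "K = (SIGMA v:dim_support \<Gamma> d. {..<d v})"
      by (auto simp: K_def dim_support_def)
    with d(3) have "finite K"
      by simp
    moreover have "M \<subseteq> module.span pm_scale (unit_vec ` K)"
      by (simp add: M(2) span_unit_vecs)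
    ultimately have "finite_dim pm_scale M"
      unfolding finite_dim_def by blast
    moreover obtain v where "v \<in> verts \<Gamma>" "d v \<noteq> 0"
      using d(2) by (auto simp: dim_support_def)
    then have "unit_vec (v, 0) \<in> M"
      by (simp add: M(2) K_def)
    then have "M \<noteq> {0}"
      by (metis lookup_single_eq lookup_zero one_neq_zero singletonD)
    ultimately show "\<exists>(scale :: 'f \<Rightarrow> ('v \<times> nat \<Rightarrow>\<^sub>0 'f) \<Rightarrow> _) M act.
        unital_right_module scale (leavitt_path_algebra \<Gamma> P) M act \<and> M \<noteq> {0} \<and> finite_dim scale M"
      using M(1) by blast
  next
    assume "\<exists>(scale :: 'f \<Rightarrow> ('v \<times> nat \<Rightarrow>\<^sub>0 'f) \<Rightarrow> _) M act.
        unital_right_module scale (leavitt_path_algebra \<Gamma> P) M act \<and> M \<noteq> {0} \<and> finite_dim scale M"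
    then show "\<exists>d. dimension_function \<Gamma> P d \<and> dim_support \<Gamma> d \<noteq> {} \<and> finite (dim_support \<Gamma> d)"
      using lpa_module.dimension_function_of_module[OF lpa_moduleI[OF assms]] by blast
  next
    fix scale :: "'f \<Rightarrow> 'm \<Rightarrow> 'm" and M act
    assume "unital_right_module scale (leavitt_path_algebra \<Gamma> P) M act \<and>
        M \<noteq> {0} \<and> finite_dim scale M"
    then show "\<exists>d. dimension_function \<Gamma> P d \<and> dim_support \<Gamma> d \<noteq> {} \<and> finite (dim_support \<Gamma> d)"
      using lpa_module.dimension_function_of_module[OF lpa_moduleI[OF assms]] by blast
  qed
qed

end
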